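(* Up to affine equivalence, there are exactly $6$ affine structures on the $2$-dimensional real abelian Lie algebra.
   Context: Let $\mathfrak g$ be a real Lie algebra of dimension $n$ with underlying vector space $A(\mathfrak g)$. Let $\mathrm{aff}(\mathbb R^n)=\left\{\begin{pmatrix}A&b\\0&0\end{pmatrix}: A\in \mathfrak{gl}(n,\mathbb R),\ b\in\mathbb R^n\right\}$, with the matrix commutator as bracket. An affine structure on $\mathfrak g$ is a Lie algebra morphism $\Psi:\mathfrak g\to \mathrm{aff}(\mathbb R^n)$, $\Psi(X)=\begin{pmatrix}A(X)&b(X)\\0&0\end{pmatrix}$, such that the linear map $b:A(\mathfrak g)\to\mathbb R^n$ is bijective. It defines a bilinear product on $A(\mathfrak g)$ by $X\cdot Y=b^{-1}(A(X)\,b(Y))$. This product satisfies $X\cdot(Y\cdot Z)-Y\cdot(X\cdot Z)=(X\cdot Y)\cdot Z-(Y\cdot X)\cdot Z$ and $X\cdot Y-Y\cdot X=[X,Y]$. When $\mathfrak g$ is abelian, the product is commutative and associative (a unit is not required). Two affine structures on an abelian Lie algebra are affinely equivalent if and only if the corresponding commutative associative real algebras are isomorphic; this is taken as the definition of affine equivalence. *)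

theory Defs
  imports "HOL-Analysis.Analysis"
begin

text \<open>A real Lie algebra is a bracket on a real vector space type \<open>'g\<close>, which plays the role of
  the underlying vector space.\<close>

definition real_lie_algebra :: "('g::real_vector \<Rightarrow> 'g \<Rightarrow> 'g) \<Rightarrow> bool" where
  "real_lie_algebra br \<longleftrightarrow>
     (\<forall>X. linear (br X)) \<and> (\<forall>Y. linear (\<lambda>X. br X Y)) \<and>
     (\<forall>X. br X X = 0) \<and>
     (\<forall>X Y Z. br X (br Y Z) + br Y (br Z X) + br Z (br X Y) = 0)"

definition abelian_bracket :: "('g::real_vector \<Rightarrow> 'g \<Rightarrow> 'g) \<Rightarrow> bool" where
  "abelian_bracket br \<longleftrightarrow> (\<forall>X Y. br X Y = 0)"

text \<open>Square matrices of size \<open>n + 1\<close> are indexed by \<open>'n option\<close>, where \<open>n = CARD('n)\<close>; the index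
  \<open>None\<close> is the last row and column of the block decomposition.\<close>

type_synonym 'n mat_ext = "real^('n option)^('n option)"

definition aff_block :: "real^'n^'n \<Rightarrow> real^'n \<Rightarrow> 'n::finite mat_ext" where
  "aff_block A b = (\<chi> i j. case i of
       None \<Rightarrow> 0
     | Some i' \<Rightarrow> (case j of None \<Rightarrow> b $ i' | Some j' \<Rightarrow> A $ i' $ j'))"

definition aff :: "'n::finite mat_ext set" where
  "aff = {aff_block A b | A b. True}"

definition linear_part :: "'n::finite mat_ext \<Rightarrow> real^'n^'n" where
  "linear_part M = (\<chi> i j. M $ Some i $ Some j)"

definition translation_part :: "'n::finite mat_ext \<Rightarrow> real^'n" where
  "translation_part M = (\<chi> i. M $ Some i $ None)"

lemma linear_part_aff_block [simp]: "linear_part (aff_block A b) = A"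
  by (simp add: linear_part_def aff_block_def)

lemma translation_part_aff_block [simp]: "translation_part (aff_block A b) = b"
  by (simp add: translation_part_def aff_block_def)

definition commutator :: "real^'m^'m \<Rightarrow> real^'m^'m \<Rightarrow> real^'m::finite^'m" where
  "commutator M N = M ** N - N ** M"

definition affine_structure ::
    "('g::real_vector \<Rightarrow> 'g \<Rightarrow> 'g) \<Rightarrow> ('g \<Rightarrow> 'n::finite mat_ext) \<Rightarrow> bool" where
  "affine_structure br \<Psi> \<longleftrightarrow>
     linear \<Psi> \<and> range \<Psi> \<subseteq> aff \<and>
     (\<forall>X Y. \<Psi> (br X Y) = commutator (\<Psi> X) (\<Psi> Y)) \<and>
     bij (\<lambda>X. translation_part (\<Psi> X))"

definition affine_product :: "('g::real_vector \<Rightarrow> 'n::finite mat_ext) \<Rightarrow> 'g \<Rightarrow> 'g \<Rightarrow> 'g" where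
  "affine_product \<Psi> X Y =
     inv (\<lambda>Z. translation_part (\<Psi> Z)) (linear_part (\<Psi> X) *v translation_part (\<Psi> Y))"

definition algebra_isomorphic ::
    "('a::real_vector \<Rightarrow> 'a \<Rightarrow> 'a) \<Rightarrow> ('b::real_vector \<Rightarrow> 'b \<Rightarrow> 'b) \<Rightarrow> bool" where
  "algebra_isomorphic p q \<longleftrightarrow>
     (\<exists>\<phi>. linear \<phi> \<and> bij \<phi> \<and> (\<forall>X Y. \<phi> (p X Y) = q (\<phi> X) (\<phi> Y)))"

definition affine_structures ::
    "('g::real_vector \<Rightarrow> 'g \<Rightarrow> 'g) \<Rightarrow> ('g \<Rightarrow> 'n::finite mat_ext) set" where
  "affine_structures br = {\<Psi>. affine_structure br \<Psi>}"

text \<open>Isomorphism of the associated algebras is affine equivalence only when the bracket is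
  abelian; the relation is used in that case only.\<close>

definition affine_equivalence ::
    "('g::real_vector \<Rightarrow> 'g \<Rightarrow> 'g) \<Rightarrow>
     (('g \<Rightarrow> 'n::finite mat_ext) \<times> ('g \<Rightarrow> 'n mat_ext)) set" where
  "affine_equivalence br =
     {(\<Psi>, \<Phi>). \<Psi> \<in> affine_structures br \<and> \<Phi> \<in> affine_structures br \<and>
        algebra_isomorphic (affine_product \<Psi>) (affine_product \<Phi>)}"

lemma algebra_isomorphic_refl: "algebra_isomorphic p p"
  unfolding algebra_isomorphic_def
  by (rule exI[of _ "\<lambda>x. x"]) (simp add: linear_iff bij_def inj_on_def)

lemma algebra_isomorphic_sym:
  assumes "algebra_isomorphic p q"
  shows "algebra_isomorphic q p"
proof -
  obtain \<phi> where lin: "linear \<phi>" and bij: "bij \<phi>" and hom: "\<And>X Y. \<phi> (p X Y) = q (\<phi> X) (\<phi> Y)"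
    using assms unfolding algebra_isomorphic_def by blast
  have [simp]: "\<phi> (inv \<phi> x) = x" "inv \<phi> (\<phi> y) = y" for x y
    using bij by (simp_all add: bij_def surj_f_inv_f)
  have "inv \<phi> (x + y) = inv \<phi> x + inv \<phi> y" for x y
    using linear_add[OF lin, of "inv \<phi> x" "inv \<phi> y"] by (metis \<open>\<And>y. inv \<phi> (\<phi> y) = y\<close> \<open>\<And>x. \<phi> (inv \<phi> x) = x\<close>)
  moreover have "inv \<phi> (c *\<^sub>R x) = c *\<^sub>R inv \<phi> x" for c x
    using linear_scale[OF lin, of c "inv \<phi> x"] by (metis \<open>\<And>y. inv \<phi> (\<phi> y) = y\<close> \<open>\<And>x. \<phi> (inv \<phi> x) = x\<close>)
  ultimately have "linear (inv \<phi>)" by (simp add: linear_iff)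
  moreover have "inv \<phi> (q X Y) = p (inv \<phi> X) (inv \<phi> Y)" for X Y
    using hom[of "inv \<phi> X" "inv \<phi> Y"] by (metis \<open>\<And>y. inv \<phi> (\<phi> y) = y\<close> \<open>\<And>x. \<phi> (inv \<phi> x) = x\<close>)
  ultimately show ?thesis
    unfolding algebra_isomorphic_def using bij_imp_bij_inv[OF bij] by blast
qed

lemma algebra_isomorphic_trans:
  assumes "algebra_isomorphic p q" "algebra_isomorphic q r"
  shows "algebra_isomorphic p r"
proof -
  obtain \<phi> \<psi> where "linear \<phi>" "bij \<phi>" "\<And>X Y. \<phi> (p X Y) = q (\<phi> X) (\<phi> Y)"
    and "linear \<psi>" "bij \<psi>" "\<And>X Y. \<psi> (q X Y) = r (\<psi> X) (\<psi> Y)"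
    using assms unfolding algebra_isomorphic_def by blast
  then show ?thesis
    unfolding algebra_isomorphic_def
    by (intro exI[of _ "\<psi> \<circ> \<phi>"]) (simp add: linear_compose bij_comp)
qed

lemma equiv_affine_equivalence: "equiv (affine_structures br) (affine_equivalence br)"
  by (rule equivI)
    (auto simp: affine_equivalence_def refl_on_def sym_def trans_def
      intro: algebra_isomorphic_refl algebra_isomorphic_sym algebra_isomorphic_trans)

end

theory Submission
  imports Defs
begin

text \<open>For an abelian bracket, the map from affine structures to their products is onto the
  commutative associative products, so it suffices to classify the latter in dimension two. If
  \<open>u\<^sup>2\<close> is a multiple of \<open>u\<close> for every \<open>u\<close>, then associativity forces the product to vanish.
  Otherwise some \<open>u\<close> and \<open>u\<^sup>2\<close> form a basis, and \<open>u\<^sup>3 = \<alpha> u + \<beta> u\<^sup>2\<close>. If \<open>\<alpha> \<noteq> 0\<close>, the algebra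
  has a unit and completing the square gives a generator with square \<open>1\<close>, \<open>0\<close> or \<open>-1\<close>. If
  \<open>\<alpha> = 0\<close>, the algebra is \<open>\<real> \<oplus> 0\<close> or nilpotent, according to whether \<open>\<beta> \<noteq> 0\<close> or \<open>\<beta> = 0\<close>.\<close>

section \<open>Affine structures and commutative associative products\<close>

locale comm_assoc_algebra =
  fixes p :: "'a::real_vector \<Rightarrow> 'a \<Rightarrow> 'a"
  assumes linear_right: "linear (p x)"
    and commute: "p x y = p y x"
    and assoc: "p (p x y) z = p x (p y z)"
begin

lemma add_right: "p x (y + z) = p x y + p x z"
  and scale_right: "p x (c *\<^sub>R y) = c *\<^sub>R p x y"
  and diff_right: "p x (y - z) = p x y - p x z"
  and zero_right: "p x 0 = 0"
  using linear_right[of x] by (simp_all add: linear_add linear_scale linear_diff linear_0)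

lemma add_left: "p (x + y) z = p x z + p y z"
  and scale_left: "p (c *\<^sub>R x) z = c *\<^sub>R p x z"
  and diff_left: "p (x - y) z = p x z - p y z"
  and zero_left: "p 0 z = 0"
  using commute[of _ z] by (simp_all add: add_right scale_right diff_right zero_right)

lemmas expand = add_right scale_right diff_right zero_right
  add_left scale_left diff_left zero_left

end

lemma aff_block_eq_iff: "aff_block A b = aff_block C d \<longleftrightarrow> A = C \<and> b = d"
  by (metis linear_part_aff_block translation_part_aff_block)

lemma aff_block_mult: "aff_block A b ** aff_block C d = aff_block (A ** C) (A *v d)"
  by (auto simp: vec_eq_iff aff_block_def matrix_matrix_mult_def matrix_vector_mult_def
      UNIV_option_conv sum.reindex split: option.splits)

lemma linear_translation_part: "linear translation_part"
  by (auto simp: linear_iff translation_part_def vec_eq_iff)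

lemma aff_block_collapse: "M \<in> aff \<Longrightarrow> aff_block (linear_part M) (translation_part M) = M"
  by (auto simp: aff_def)

lemma inv_linear:
  assumes "linear f" "bij f"
  shows "linear (inv f)"
  by (metis assms bij_def linear_injective_left_inverse inv_unique_comp linear_surjective_right_inverse
      left_right_inverse_eq)

text \<open>Under an abelian bracket the matrices \<open>\<Psi> X\<close> commute. Their linear
  blocks say that left multiplications commute, their translation blocks that the product is
  commutative. Together these give associativity:
  \<open>(XY)Z = Z(XY) = X(ZY) = X(YZ)\<close>.\<close>

lemma comm_assoc_affine_product:
  fixes \<Psi> :: "'g::real_vector \<Rightarrow> 'n::finite mat_ext"
  assumes ab: "abelian_bracket br" and aff: "affine_structure br \<Psi>"
  shows "comm_assoc_algebra (affine_product \<Psi>)"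
proof -
  define b where "b = (\<lambda>X. translation_part (\<Psi> X))"
  define A where "A = (\<lambda>X. linear_part (\<Psi> X))"
  have lin: "linear \<Psi>" and bij: "bij b"
    using aff by (auto simp: affine_structure_def b_def)
  have linb: "linear b"
    unfolding b_def using linear_compose[OF lin linear_translation_part] by (simp add: o_def)
  have b_inv [simp]: "b (inv b v) = v" "inv b (b X) = X" for v X
    using bij by (simp_all add: bij_def surj_f_inv_f)
  have \<Psi>: "\<Psi> X = aff_block (A X) (b X)" for X
    using aff by (metis A_def b_def affine_structure_def aff_block_collapse range_subsetD)
  \<comment> \<open>The commutator is \<open>\<Psi> (br X Y) = \<Psi> 0 = 0\<close>.\<close>
  have "\<Psi> X ** \<Psi> Y = \<Psi> Y ** \<Psi> X" for X Y
    using aff ab linear_0[OF lin]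
    by (simp add: affine_structure_def abelian_bracket_def commutator_def)
  then have A_comm: "A X ** A Y = A Y ** A X" and b_comm: "A X *v b Y = A Y *v b X" for X Y
    unfolding \<Psi> aff_block_mult aff_block_eq_iff by auto
  have prod: "affine_product \<Psi> X Y = inv b (A X *v b Y)" for X Y
    by (simp add: affine_product_def b_def A_def)
  have comm: "affine_product \<Psi> X Y = affine_product \<Psi> Y X" for X Y
    by (simp add: prod b_comm)
  have swap: "affine_product \<Psi> X (affine_product \<Psi> Y Z) = affine_product \<Psi> Y (affine_product \<Psi> X Z)"
    for X Y Z
    by (simp add: prod matrix_vector_mul_assoc A_comm)
  show ?thesis
  proof (rule comm_assoc_algebra.intro)
    show "linear (affine_product \<Psi> X)" for X
      using linear_compose[OF linear_compose[OF linb matrix_vector_mul_linear[of "A X"]]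
          inv_linear[OF linb bij]]
      by (simp add: prod[abs_def] o_def)
    show "affine_product \<Psi> (affine_product \<Psi> X Y) Z = affine_product \<Psi> X (affine_product \<Psi> Y Z)"
      for X Y Z
      by (metis comm swap)
  qed (rule comm)
qed

text \<open>The structure is the left regular representation, read in coordinates through
  \<open>\<beta>\<close>, with \<open>\<beta>\<close> itself as translation part. Faithfulness comes
  from the translation part, so the algebra may lack a unit or even have zero product.\<close>

lemma comm_assoc_algebra_is_affine_product:
  fixes p :: "'g::real_vector \<Rightarrow> 'g \<Rightarrow> 'g" and \<beta> :: "'g \<Rightarrow> real^'n::finite"
  assumes ab: "abelian_bracket br" and p: "comm_assoc_algebra p"
    and \<beta>: "linear \<beta>" "bij \<beta>"
  obtains \<Psi> :: "'g \<Rightarrow> 'n mat_ext" where "affine_structure br \<Psi>" "affine_product \<Psi> = p"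
proof -
  interpret comm_assoc_algebra p by (rule p)
  define A where "A X = matrix (\<lambda>w. \<beta> (p X (inv \<beta> w)))" for X
  define \<Psi> where "\<Psi> X = aff_block (A X) (\<beta> X)" for X
  have \<beta>_inv [simp]: "\<beta> (inv \<beta> v) = v" "inv \<beta> (\<beta> X) = X" for v X
    using \<beta>(2) by (simp_all add: bij_def surj_f_inv_f)
  have A: "A X *v w = \<beta> (p X (inv \<beta> w))" for X w
  proof -
    have "linear (\<lambda>w. \<beta> (p X (inv \<beta> w)))"
      using linear_compose[OF linear_compose[OF inv_linear[OF \<beta>] linear_right[of X]] \<beta>(1)]
      by (simp add: o_def)
    then show ?thesis by (simp add: A_def matrix_works)
  qed
  have A_eqI: "M = N" if "\<And>w. M *v w = N *v w" for M N :: "real^'n^'n"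
    using that by (simp add: matrix_eq)
  have A_add: "A (X + Y) = A X + A Y" and A_scale: "A (c *\<^sub>R X) = c *\<^sub>R A X" for X Y c
    by (rule A_eqI; simp add: A expand linear_add[OF \<beta>(1)] linear_scale[OF \<beta>(1)]
        matrix_vector_mult_add_rdistrib scaleR_matrix_vector_assoc[symmetric])+
  have "linear \<Psi>"
    by (auto simp: linear_iff \<Psi>_def A_add A_scale linear_add[OF \<beta>(1)] linear_scale[OF \<beta>(1)]
        aff_block_def vec_eq_iff split: option.splits)
  moreover have "\<Psi> X ** \<Psi> Y = \<Psi> Y ** \<Psi> X" for X Y
  proof -
    \<comment> \<open>Left multiplications commute:
      \<open>X(YZ) = (XY)Z = (YX)Z = Y(XZ)\<close>.\<close>
    have "A X ** A Y = A Y ** A X"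
      by (rule A_eqI) (simp add: A matrix_vector_mul_assoc[symmetric], metis assoc commute)
    then show ?thesis
      by (simp add: \<Psi>_def aff_block_mult A commute[of X Y])
  qed
  moreover have "range \<Psi> \<subseteq> aff"
    by (auto simp: \<Psi>_def aff_def)
  moreover have "bij (\<lambda>X. translation_part (\<Psi> X))"
    using \<beta>(2) by (simp add: \<Psi>_def)
  ultimately have "affine_structure br \<Psi>"
    using ab by (simp add: affine_structure_def abelian_bracket_def commutator_def linear_0)
  moreover have "affine_product \<Psi> = p"
    by (simp add: fun_eq_iff affine_product_def \<Psi>_def A)
  ultimately show thesis by (rule that)
qed

section \<open>Two-dimensional algebras in a basis\<close>

text \<open>The coordinate map of the pair \<open>u\<close>, \<open>v\<close>; below,
  \<open>bij (comb u v)\<close> expresses that the pair is a basis.\<close>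

definition comb :: "'a::real_vector \<Rightarrow> 'a \<Rightarrow> real \<times> real \<Rightarrow> 'a" where
  "comb u v w = fst w *\<^sub>R u + snd w *\<^sub>R v"

lemma linear_comb: "linear (comb u v)"
  by (auto simp: linear_iff comb_def algebra_simps)

lemma bij_comb_exists:
  assumes "dim (UNIV :: 'a::real_vector set) = 2"
  obtains u v :: "'a::real_vector" where "bij (comb u v)"
proof -
  obtain B :: "'a set" where B: "independent B" "UNIV \<subseteq> span B" and card: "card B = dim (UNIV :: 'a set)"
    by (rule basis_exists[of UNIV])
  obtain u v where uv: "B = {u, v}" "u \<noteq> v"
    using card unfolding assms card_2_iff by blast
  have "w = 0" if "comb u v w = 0" for w
  proof -
    \<comment> \<open>A nonzero first coordinate would put \<open>u\<close> into the span of
      \<open>v\<close>.\<close>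
    have "fst w = 0"
    proof (rule ccontr)
      assume "fst w \<noteq> 0"
      moreover have "fst w *\<^sub>R u = (- snd w) *\<^sub>R v"
        using that by (simp add: comb_def eq_neg_iff_add_eq_0)
      then have "(1 / fst w) *\<^sub>R (fst w *\<^sub>R u) = (1 / fst w) *\<^sub>R ((- snd w) *\<^sub>R v)"
        by (rule arg_cong)
      ultimately have "u = (- snd w / fst w) *\<^sub>R v" by simp
      then have "u \<in> span {v}" by (metis span_base span_scale singletonI)
      then show False using B(1) uv by (simp add: independent_insert)
    qed
    then show ?thesis
      using that B(1) uv dependent_zero[of B] by (cases w) (auto simp: comb_def zero_prod_def)
  qed
  then have "inj (comb u v)"
    by (simp add: linear_injective_0[OF linear_comb])
  moreover have "x \<in> range (comb u v)" for x
  proof -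
    have "x \<in> span {u, v}" using B(2) uv by auto
    then obtain a b where "x - a *\<^sub>R u = b *\<^sub>R v"
      by (auto simp: span_insert span_singleton)
    then have "x = comb u v (a, b)" by (simp add: comb_def algebra_simps)
    then show ?thesis by blast
  qed
  ultimately show thesis
    using that[of u v] by (auto simp: bij_def)
qed

lemma bij_comb_change:
  assumes "bij (comb u v)" and det: "a * d - b * c \<noteq> 0"
  shows "bij (comb (comb u v (a, b)) (comb u v (c, d)))"
proof -
  define f :: "real \<times> real \<Rightarrow> real \<times> real"
    where "f = (\<lambda>w. (fst w * a + snd w * c, fst w * b + snd w * d))"
  \<comment> \<open>The inverse of \<open>f\<close> by Cramer's rule.\<close>
  define g :: "real \<times> real \<Rightarrow> real \<times> real"
    where "g = (\<lambda>w. ((fst w * d - snd w * c) / (a * d - b * c),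
                     (snd w * a - fst w * b) / (a * d - b * c)))"
  have "f (g w) = w" "g (f w) = w" for w
    using det by (cases w; simp add: f_def g_def divide_simps; simp add: algebra_simps)+
  then have "bij f" by (metis bijI' )
  moreover have "comb (comb u v (a, b)) (comb u v (c, d)) = comb u v \<circ> f"
    by (auto simp: comb_def f_def algebra_simps)
  ultimately show ?thesis using assms(1) by (simp add: bij_comp)
qed

text \<open>The vectors \<open>A\<close>, \<open>B\<close>, \<open>C\<close> hold the coordinates of \<open>u\<^sup>2\<close>, \<open>u v\<close>, \<open>v\<^sup>2\<close> for a basis \<open>u, v\<close>.\<close>

definition table :: "(real \<times> real) \<times> (real \<times> real) \<times> (real \<times> real)
    \<Rightarrow> real \<times> real \<Rightarrow> real \<times> real \<Rightarrow> real \<times> real" where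
  "table = (\<lambda>(A, B, C) x y.
     (fst x * fst y) *\<^sub>R A + (fst x * snd y + snd x * fst y) *\<^sub>R B + (snd x * snd y) *\<^sub>R C)"

text \<open>A commutative bilinear product is determined by \<open>u^2\<close>, \<open>uv\<close>
  and \<open>v^2\<close>, so the coordinate map \<open>comb u v\<close> is itself the
  isomorphism.\<close>

lemma (in comm_assoc_algebra) table_iso:
  assumes "bij (comb u v)"
    and "p u u = comb u v A" "p u v = comb u v B" "p v v = comb u v C"
  shows "algebra_isomorphic (table (A, B, C)) p"
proof -
  have "comb u v (table (A, B, C) x y) = p (comb u v x) (comb u v y)" for x y
  proof -
    have "p (comb u v x) (comb u v y) = (fst x * fst y) *\<^sub>R p u u
        + (fst x * snd y + snd x * fst y) *\<^sub>R p u v + (snd x * snd y) *\<^sub>R p v v"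
      by (simp add: comb_def expand commute[of v u] algebra_simps)
    then show ?thesis
      unfolding assms(2-4)
      by (simp add: table_def linear_add[OF linear_comb] linear_scale[OF linear_comb])
  qed
  then show ?thesis
    unfolding algebra_isomorphic_def using assms(1) linear_comb by blast
qed

text \<open>In this order: the zero product, \<open>\<real> \<oplus> 0\<close>, the nilpotent algebra \<open>u\<^sup>2 = v\<close>, and the unital
  algebras \<open>\<real>[v]\<close> with \<open>v\<^sup>2\<close> equal to \<open>1\<close>, \<open>0\<close>, \<open>-1\<close>.\<close>

definition canonical_tables :: "((real \<times> real) \<times> (real \<times> real) \<times> (real \<times> real)) set" where
  "canonical_tables = {((0,0), (0,0), (0,0)), ((1,0), (0,0), (0,0)), ((0,1), (0,0), (0,0)),
     ((1,0), (0,1), (1,0)), ((1,0), (0,1), (0,0)), ((1,0), (0,1), (-1,0))}"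

lemma card_canonical_tables: "card canonical_tables = 6"
  by (simp add: canonical_tables_def)

lemma comm_assoc_canonical_table:
  assumes "T \<in> canonical_tables"
  shows "comm_assoc_algebra (table T)"
  using assms unfolding canonical_tables_def
  by (intro comm_assoc_algebra.intro) (auto simp: table_def linear_iff algebra_simps)

section \<open>Classification\<close>

context comm_assoc_algebra
begin

text \<open>Polarization with \<open>u + v\<close> and \<open>u - v\<close> forces
  \<open>2uv = b u + a v\<close>, where \<open>u^2 = a u\<close> and \<open>v^2 = b v\<close>;
  associativity then kills \<open>a\<close> and \<open>b\<close>.\<close>

lemma zero_if_squares_proportional:
  assumes uv: "bij (comb u v)" and sq: "\<And>w. \<exists>c. p w w = c *\<^sub>R w"
  shows "p u u = 0" "p u v = 0" "p v v = 0"
proof -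
  have eqD: "x = y" if "comb u v x = comb u v y" for x y
    using uv that by (meson bij_def injD)
  obtain a b c d where sqs: "p u u = a *\<^sub>R u" "p v v = b *\<^sub>R v"
    "p (u + v) (u + v) = c *\<^sub>R (u + v)" "p (u - v) (u - v) = d *\<^sub>R (u - v)"
    using sq by metis
  have uv2: "2 *\<^sub>R p u v = (c - a) *\<^sub>R u + (c - b) *\<^sub>R v"
    using sqs(3) sqs(1,2) by (simp add: expand commute[of v u] algebra_simps scaleR_2)
  have "2 *\<^sub>R p u v = (a - d) *\<^sub>R u + (b + d) *\<^sub>R v"
    using sqs(4) sqs(1,2) by (simp add: expand commute[of v u] algebra_simps scaleR_2)
  with uv2 have "comb u v (c - a, c - b) = comb u v (a - d, b + d)"
    by (simp add: comb_def)
  \<comment> \<open>Adding the coordinate equations \<open>c - a = a - d\<close> and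
    \<open>c - b = b + d\<close> eliminates \<open>d\<close>.\<close>
  then have "c = a + b" by (auto dest!: eqD)
  with uv2 have uv3: "2 *\<^sub>R p u v = b *\<^sub>R u + a *\<^sub>R v" by simp
  have "p u v = (1/2) *\<^sub>R (2 *\<^sub>R p u v)" by simp
  then have puv: "p u v = (b/2) *\<^sub>R u + (a/2) *\<^sub>R v"
    unfolding uv3 by (simp add: scaleR_add_right)
  \<comment> \<open>The second coordinates of \<open>(uu)v = u(uv)\<close> give
    \<open>a^2/2 = a^2/4\<close>. Symmetrically, the first coordinates of
    \<open>u(vv) = (uv)v\<close> give \<open>b = 0\<close>.\<close>
  have "comb u v (a * b / 2, a * a / 2) = p (p u u) v"
    by (simp add: sqs puv expand comb_def algebra_simps)
  also have "\<dots> = p u (p u v)" by (rule assoc)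
  also have "\<dots> = comb u v (a * b / 2 + a * b / 4, a * a / 4)"
    by (simp add: sqs puv expand comb_def algebra_simps, simp flip: scaleR_add_left)
  finally have "a = 0" by (auto dest!: eqD)
  have "comb u v (b * b / 2, a * b / 2) = p u (p v v)"
    by (simp add: sqs puv expand comb_def algebra_simps)
  also have "\<dots> = p (p u v) v" by (rule assoc[symmetric])
  also have "\<dots> = comb u v (b * b / 4, a * b / 2 + a * b / 4)"
    by (simp add: sqs puv expand comb_def algebra_simps, simp flip: scaleR_add_left)
  finally have "b = 0" by (auto dest!: eqD)
  show "p u u = 0" "p u v = 0" "p v v = 0"
    using sqs puv \<open>a = 0\<close> \<open>b = 0\<close> by auto
qed

text \<open>Rescaling \<open>w\<close> by \<open>s\<close> multiplies \<open>t\<close> by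
  \<open>s^2\<close>, so only the sign of \<open>t\<close> matters.\<close>

lemma unital_classification:
  assumes ew: "bij (comb e w)" and unit: "p e e = e" "p e w = w" and w: "p w w = t *\<^sub>R e"
  shows "\<exists>T \<in> canonical_tables. algebra_isomorphic (table T) p"
proof -
  \<comment> \<open>Chosen so that \<open>s^2 t = sgn t\<close>; the value 1 at \<open>t = 0\<close>
    keeps \<open>s\<close> nonzero.\<close>
  define s where "s = (if t = 0 then 1 else 1 / sqrt \<bar>t\<bar>)"
  have s: "s \<noteq> 0" and st: "s * s * t = sgn t"
    by (auto simp: s_def sgn_if)
  have "bij (comb e (s *\<^sub>R w))"
    using bij_comb_change[OF ew, of 1 s 0 0] s by (simp add: comb_def)
  then have "algebra_isomorphic (table ((1,0), (0,1), (sgn t, 0))) p"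
    using st by (intro table_iso[OF \<open>bij (comb e (s *\<^sub>R w))\<close>])
      (simp_all add: comb_def unit w expand)
  moreover have "((1,0), (0,1), (sgn t, 0)) \<in> canonical_tables"
    by (auto simp: canonical_tables_def sgn_if)
  ultimately show ?thesis by blast
qed

text \<open>The algebra is the ideal generated by \<open>x\<close> in the real polynomials modulo
  \<open>x (x^2 - \<beta> x - \<alpha>)\<close>, with \<open>u\<close> as the class of
  \<open>x\<close>. The cases record whether 0 is a simple, double or triple root of that
  cubic.\<close>

lemma cyclic_classification:
  assumes u: "bij (comb u (p u u))"
  shows "\<exists>T \<in> canonical_tables. algebra_isomorphic (table T) p"
proof -
  define v where "v = p u u"
  have uv: "bij (comb u v)" using u by (simp add: v_def)
  obtain \<alpha> \<beta> where u3: "p u v = \<alpha> *\<^sub>R u + \<beta> *\<^sub>R v"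
    using uv unfolding bij_def surj_def comb_def by metis
  have vv: "p v v = p u (p u v)" by (metis v_def assoc)
  consider "\<alpha> \<noteq> 0" | "\<alpha> = 0" "\<beta> = 0" | "\<alpha> = 0" "\<beta> \<noteq> 0" by blast
  then show ?thesis
  proof cases
    case 1
    \<comment> \<open>From \<open>uv = \<alpha> u + \<beta> v\<close> follows
      \<open>(v - \<beta> u) u = \<alpha> u\<close>, so \<open>e\<close> fixes \<open>u\<close>,
      hence also \<open>v = u^2\<close>.\<close>
    define e where "e = (1/\<alpha>) *\<^sub>R (v - \<beta> *\<^sub>R u)"
    \<comment> \<open>Completing the square in \<open>u^2 = \<alpha> e + \<beta> u\<close> makes
      \<open>w^2\<close> a multiple of \<open>e\<close>.\<close>
    define w where "w = u - (\<beta>/2) *\<^sub>R e"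
    have eu: "p e u = u"
      using 1 by (simp add: e_def expand commute[of v u] u3 flip: v_def)
    then have ev: "p e v = v" by (metis assoc v_def)
    have ee: "p e e = e"
      \<comment> \<open>Only the second factor and the right-hand side are unfolded; the remaining
        \<open>e\<close> then acts by \<open>eu\<close> and \<open>ev\<close>.\<close>
      by (subst (2) e_def, subst (2) e_def) (simp add: expand eu ev)
    have ew: "p e w = w" by (simp add: w_def expand eu ee)
    have v: "v = \<alpha> *\<^sub>R e + \<beta> *\<^sub>R u" using 1 by (simp add: e_def)
    have "p w w = p u u - \<beta> *\<^sub>R u + (\<beta> * \<beta> / 4) *\<^sub>R e"
      by (simp add: w_def expand eu commute[of u e] ee algebra_simps flip: scaleR_add_left)
    then have "p w w = (\<alpha> + \<beta> * \<beta> / 4) *\<^sub>R e"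
      using v by (simp add: v_def algebra_simps)
    moreover have "bij (comb e w)"
    proof -
      have "e = comb u v (- \<beta>/\<alpha>, 1/\<alpha>)" "w = comb u v (1 + \<beta>*\<beta>/(2*\<alpha>), - \<beta>/(2*\<alpha>))"
        by (simp_all add: comb_def e_def w_def algebra_simps)
      \<comment> \<open>This determinant equals \<open>- 1/\<alpha>\<close>.\<close>
      moreover have "- \<beta>/\<alpha> * (- \<beta>/(2*\<alpha>)) - 1/\<alpha> * (1 + \<beta>*\<beta>/(2*\<alpha>)) \<noteq> 0"
        using 1 by (simp add: field_simps)
      ultimately show ?thesis using bij_comb_change[OF uv] by metis
    qed
    ultimately show ?thesis by (intro unital_classification[OF _ ee ew])
  next
    case 2
    have "algebra_isomorphic (table ((0,1), (0,0), (0,0))) p"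
      using 2 u3 by (intro table_iso[OF uv]) (simp_all add: comb_def v_def[symmetric] vv expand)
    then show ?thesis by (auto simp: canonical_tables_def)
  next
    case 3
    \<comment> \<open>Here \<open>uv = \<beta> v\<close> and \<open>v^2 = \<beta>^2 v\<close>, so
      \<open>e\<close> is idempotent, while \<open>n\<close> is annihilated by both \<open>u\<close>
      and \<open>v\<close>.\<close>
    define e where "e = (1/(\<beta>*\<beta>)) *\<^sub>R v"
    define n where "n = u - (1/\<beta>) *\<^sub>R v"
    have uv': "p u v = \<beta> *\<^sub>R v" using 3 u3 by simp
    have vv': "p v v = (\<beta>*\<beta>) *\<^sub>R v" by (simp add: vv uv' expand)
    have "e = comb u v (0, 1/(\<beta>*\<beta>))" "n = comb u v (1, - 1/\<beta>)"
      by (simp_all add: comb_def e_def n_def)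
    moreover have "0 * (- 1/\<beta>) - 1/(\<beta>*\<beta>) * 1 \<noteq> 0" using 3 by simp
    ultimately have "bij (comb e n)" using bij_comb_change[OF uv] by metis
    moreover have vn: "p v n = 0" and un: "p u n = 0"
      using 3 by (simp_all add: n_def expand uv' vv' commute[of v u] flip: v_def)
    moreover have "p n n = p u n - (1/\<beta>) *\<^sub>R p v n"
      by (subst n_def) (simp only: expand)
    then have "p n n = 0" by (simp add: un vn)
    moreover have "p e e = e" "p e n = 0"
      using 3 by (simp_all add: e_def expand vv' vn)
    ultimately have "algebra_isomorphic (table ((1,0), (0,0), (0,0))) p"
      by (intro table_iso[of e n]) (simp_all add: comb_def)
    then show ?thesis by (auto simp: canonical_tables_def)
  qed
qed

lemma classification:
  assumes dim: "dim (UNIV :: 'a set) = 2"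
  shows "\<exists>T \<in> canonical_tables. algebra_isomorphic (table T) p"
proof (cases "\<forall>w. \<exists>c. p w w = c *\<^sub>R w")
  case True
  obtain u v :: 'a where uv: "bij (comb u v)" by (rule bij_comb_exists[OF dim])
  have "algebra_isomorphic (table ((0,0), (0,0), (0,0))) p"
    using zero_if_squares_proportional[OF uv] True by (intro table_iso[OF uv]) (auto simp: comb_def)
  then show ?thesis by (auto simp: canonical_tables_def)
next
  case False
  then obtain w where w: "\<And>c. p w w \<noteq> c *\<^sub>R w" by blast
  obtain u v :: 'a where uv: "bij (comb u v)" by (rule bij_comb_exists[OF dim])
  obtain a b c d where ab: "w = comb u v (a, b)" and cd: "p w w = comb u v (c, d)"
    using uv unfolding bij_def surj_def by (metis surj_pair)
  \<comment> \<open>Since \<open>w\<close> is nonzero, a vanishing determinant would make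
    \<open>w^2\<close> a multiple of \<open>w\<close>, with factor \<open>c/a\<close> or
    \<open>d/b\<close>.\<close>
  have "a * d - b * c \<noteq> 0"
  proof
    assume det: "a * d - b * c = 0"
    have "w \<noteq> 0" using w zero_left by force
    then have "a \<noteq> 0 \<or> b \<noteq> 0" using ab by (auto simp: comb_def)
    then show False
    proof
      assume 1: "a \<noteq> 0"
      then have "d = c / a * b" using det by (simp add: field_simps)
      then have "p w w = (c / a) *\<^sub>R w" using 1 by (simp add: cd, simp add: ab comb_def algebra_simps)
      then show False using w by blast
    next
      assume 2: "b \<noteq> 0"
      then have "c = d / b * a" using det by (simp add: field_simps)
      then have "p w w = (d / b) *\<^sub>R w" using 2 by (simp add: cd, simp add: ab comb_def algebra_simps)
      then show False using w by blast
    qed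
  qed
  then have "bij (comb w (p w w))" using bij_comb_change[OF uv] ab cd by simp
  then show ?thesis by (rule cyclic_classification)
qed

end

section \<open>The canonical algebras are pairwise non-isomorphic\<close>

definition zero_product :: "('a::real_vector \<Rightarrow> 'a \<Rightarrow> 'a) \<Rightarrow> bool" where
  "zero_product p \<longleftrightarrow> (\<forall>x y. p x y = 0)"

definition has_idempotent :: "('a::real_vector \<Rightarrow> 'a \<Rightarrow> 'a) \<Rightarrow> bool" where
  "has_idempotent p \<longleftrightarrow> (\<exists>x. x \<noteq> 0 \<and> p x x = x)"

definition has_unit :: "('a::real_vector \<Rightarrow> 'a \<Rightarrow> 'a) \<Rightarrow> bool" where
  "has_unit p \<longleftrightarrow> (\<exists>e. \<forall>x. p e x = x)"

definition has_square_zero :: "('a::real_vector \<Rightarrow> 'a \<Rightarrow> 'a) \<Rightarrow> bool" where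
  "has_square_zero p \<longleftrightarrow> (\<exists>x. x \<noteq> 0 \<and> p x x = 0)"

definition has_zero_divisors :: "('a::real_vector \<Rightarrow> 'a \<Rightarrow> 'a) \<Rightarrow> bool" where
  "has_zero_divisors p \<longleftrightarrow> (\<exists>x y. x \<noteq> 0 \<and> y \<noteq> 0 \<and> p x y = 0)"

text \<open>By surjectivity the quantifiers over the target may range over images of
  \<open>\<phi>\<close>; multiplicativity and injectivity then pull each condition back.\<close>

lemma algebra_isomorphic_invariants:
  assumes "algebra_isomorphic p q"
  shows "zero_product p \<longleftrightarrow> zero_product q" "has_idempotent p \<longleftrightarrow> has_idempotent q"
    "has_unit p \<longleftrightarrow> has_unit q" "has_square_zero p \<longleftrightarrow> has_square_zero q"
    "has_zero_divisors p \<longleftrightarrow> has_zero_divisors q"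
proof -
  obtain \<phi> where \<phi>: "linear \<phi>" "bij \<phi>" and hom: "\<And>x y. \<phi> (p x y) = q (\<phi> x) (\<phi> y)"
    using assms unfolding algebra_isomorphic_def by blast
  have surj: "\<exists>x. y = \<phi> x" for y
    using \<phi>(2) by (metis bij_pointE)
  have eq: "\<phi> x = \<phi> y \<longleftrightarrow> x = y" and zero: "\<phi> x = 0 \<longleftrightarrow> x = 0" for x y
    using \<phi> by (metis bij_def injD linear_0)+
  have "zero_product q \<longleftrightarrow> (\<forall>x y. q (\<phi> x) (\<phi> y) = 0)"
    unfolding zero_product_def by (metis surj)
  then show "zero_product p \<longleftrightarrow> zero_product q"
    by (simp add: zero_product_def zero flip: hom)
  have "has_idempotent q \<longleftrightarrow> (\<exists>x. \<phi> x \<noteq> 0 \<and> q (\<phi> x) (\<phi> x) = \<phi> x)"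
    unfolding has_idempotent_def by (metis surj)
  then show "has_idempotent p \<longleftrightarrow> has_idempotent q"
    by (simp add: has_idempotent_def zero eq flip: hom)
  have "has_unit q \<longleftrightarrow> (\<exists>e. \<forall>x. q (\<phi> e) (\<phi> x) = \<phi> x)"
    unfolding has_unit_def by (metis surj)
  then show "has_unit p \<longleftrightarrow> has_unit q"
    by (simp add: has_unit_def eq flip: hom)
  have "has_square_zero q \<longleftrightarrow> (\<exists>x. \<phi> x \<noteq> 0 \<and> q (\<phi> x) (\<phi> x) = 0)"
    unfolding has_square_zero_def by (metis surj)
  then show "has_square_zero p \<longleftrightarrow> has_square_zero q"
    by (simp add: has_square_zero_def zero flip: hom)
  have "has_zero_divisors q \<longleftrightarrow> (\<exists>x y. \<phi> x \<noteq> 0 \<and> \<phi> y \<noteq> 0 \<and> q (\<phi> x) (\<phi> y) = 0)"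
    unfolding has_zero_divisors_def by (metis surj)
  then show "has_zero_divisors p \<longleftrightarrow> has_zero_divisors q"
    by (simp add: has_zero_divisors_def zero flip: hom)
qed

lemma invariants_zero: "zero_product (table ((0,0), (0,0), (0,0)))"
    "\<not> has_idempotent (table ((0,0), (0,0), (0,0)))"
  by (auto simp: zero_product_def has_idempotent_def table_def zero_prod_def)

lemma invariants_nilpotent: "\<not> zero_product (table ((0,1), (0,0), (0,0)))"
    "\<not> has_idempotent (table ((0,1), (0,0), (0,0)))"
proof -
  have "table ((0,1), (0,0), (0,0)) (1,0) (1,0) \<noteq> 0"
    by (simp add: table_def zero_prod_def)
  then show "\<not> zero_product (table ((0,1), (0,0), (0,0)))"
    unfolding zero_product_def by blast
  \<comment> \<open>Squares have first coordinate 0 and second coordinate \<open>(fst x)^2\<close>,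
    so an idempotent loses first one coordinate, then the other.\<close>
  have "x = 0" if "table ((0,1), (0,0), (0,0)) x x = x" for x
    using that by (cases x) (auto simp: table_def zero_prod_def)
  then show "\<not> has_idempotent (table ((0,1), (0,0), (0,0)))"
    unfolding has_idempotent_def by blast
qed

lemma invariants_idempotent: "has_idempotent (table ((1,0), (0,0), (0,0)))"
    "\<not> has_unit (table ((1,0), (0,0), (0,0)))"
proof -
  show "has_idempotent (table ((1,0), (0,0), (0,0)))"
    unfolding has_idempotent_def by (rule exI[of _ "(1,0)"]) (simp add: table_def zero_prod_def)
  \<comment> \<open>The vector \<open>(0,1)\<close> is annihilated by every element.\<close>
  have "table ((1,0), (0,0), (0,0)) e (0,1) \<noteq> (0,1)" for e
    by (simp add: table_def)
  then show "\<not> has_unit (table ((1,0), (0,0), (0,0)))"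
    unfolding has_unit_def by blast
qed

lemma invariants_unital:
  shows "has_idempotent (table ((1,0), (0,1), (t,0)))"
    and "has_unit (table ((1,0), (0,1), (t,0)))"
    and "has_square_zero (table ((1,0), (0,1), (t,0))) \<longleftrightarrow> t = 0"
    and "has_zero_divisors (table ((1,0), (0,1), (1,0)))"
    and "\<not> has_zero_divisors (table ((1,0), (0,1), (-1,0)))"
proof -
  show "has_idempotent (table ((1,0), (0,1), (t,0)))"
    unfolding has_idempotent_def by (rule exI[of _ "(1,0)"]) (simp add: table_def zero_prod_def)
  show "has_unit (table ((1,0), (0,1), (t,0)))"
    unfolding has_unit_def by (rule exI[of _ "(1,0)"]) (simp add: table_def)
  \<comment> \<open>The square of \<open>(a,b)\<close> is \<open>(a^2 + t b^2, 2ab)\<close>.\<close>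
  show "has_square_zero (table ((1,0), (0,1), (t,0))) \<longleftrightarrow> t = 0"
    by (auto simp: has_square_zero_def table_def zero_prod_def)
  show "has_zero_divisors (table ((1,0), (0,1), (1,0)))"
    unfolding has_zero_divisors_def
    \<comment> \<open>The witnesses are the factors in
      \<open>(1 + v)(1 - v) = 1 - v^2 = 0\<close>.\<close>
    by (rule exI[of _ "(1,1)"], rule exI[of _ "(1,-1)"]) (simp add: table_def zero_prod_def)
  show "\<not> has_zero_divisors (table ((1,0), (0,1), (-1,0)))"
  proof -
    have "x = 0 \<or> y = 0" if "table ((1,0), (0,1), (-1,0)) x y = 0" for x y
    proof -
      \<comment> \<open>With \<open>v^2 = -1\<close> the table is complex multiplication.\<close>
      have "Complex (fst x) (snd x) * Complex (fst y) (snd y) = 0"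
        using that by (simp add: table_def complex_eq_iff zero_prod_def algebra_simps)
      then have "Complex (fst x) (snd x) = 0 \<or> Complex (fst y) (snd y) = 0" by simp
      then show ?thesis by (auto simp: complex_eq_iff prod_eq_iff)
    qed
    then show ?thesis by (auto simp: has_zero_divisors_def)
  qed
qed

text \<open>The zero and nilpotent algebras have no nonzero idempotent and differ in whether the
  product vanishes. Among the others only \<real> \<oplus> 0 lacks a unit; of the unital ones only
  \<open>v^2 = 0\<close> has a nonzero element of square zero, and zero divisors separate
  \<open>v^2 = 1\<close> from \<open>v^2 = -1\<close>.\<close>

lemma canonical_tables_distinct:
  assumes "S \<in> canonical_tables" "T \<in> canonical_tables"
    and iso: "algebra_isomorphic (table S) (table T)"
  shows "S = T"
  using assms(1,2) algebra_isomorphic_invariants[OF iso]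
  unfolding canonical_tables_def insert_iff empty_iff
  by (elim disjE) (simp_all add: invariants_zero invariants_nilpotent invariants_idempotent invariants_unital)

section \<open>Counting the classes\<close>

text \<open>Counts classes through a system of representatives \<open>f\<close> indexed by
  \<open>K\<close>.\<close>

lemma card_quotient_eq:
  assumes r: "equiv A r" and f: "\<And>k. k \<in> K \<Longrightarrow> f k \<in> A"
    and onto: "\<And>a. a \<in> A \<Longrightarrow> \<exists>k\<in>K. (f k, a) \<in> r"
    and inj: "\<And>k l. \<lbrakk>k \<in> K; l \<in> K; (f k, f l) \<in> r\<rbrakk> \<Longrightarrow> k = l"
  shows "card (A // r) = card K"
proof -
  have "bij_betw (\<lambda>k. r `` {f k}) K (A // r)"
    unfolding bij_betw_def
  proof
    show "inj_on (\<lambda>k. r `` {f k}) K"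
      by (intro inj_onI inj) (auto intro: eq_equiv_class[OF _ r] f)
    have "r `` {a} \<in> (\<lambda>k. r `` {f k}) ` K" if "a \<in> A" for a
      using onto[OF that] equiv_class_eq[OF r] by blast
    then show "(\<lambda>k. r `` {f k}) ` K = A // r"
      using f by (auto simp: quotientI elim!: quotientE)
  qed
  then show ?thesis by (simp add: bij_betw_same_card)
qed

text \<open>Serves to move the tables, which are products on pairs of reals, to the vector space
  \<open>'g\<close> that carries the affine structures.\<close>

lemma algebra_isomorphic_transport:
  fixes p :: "'a::real_vector \<Rightarrow> 'a \<Rightarrow> 'a" and \<phi> :: "'a \<Rightarrow> 'b::real_vector"
  assumes p: "comm_assoc_algebra p" and \<phi>: "linear \<phi>" "bij \<phi>"
  obtains q :: "'b \<Rightarrow> 'b \<Rightarrow> 'b" where "comm_assoc_algebra q" "algebra_isomorphic p q"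
proof -
  interpret comm_assoc_algebra p by (rule p)
  define q where "q = (\<lambda>x y. \<phi> (p (inv \<phi> x) (inv \<phi> y)))"
  have [simp]: "inv \<phi> (\<phi> x) = x" for x
    using \<phi>(2) by (simp add: bij_def)
  have "comm_assoc_algebra q"
  proof (rule comm_assoc_algebra.intro)
    show "linear (q x)" for x
      using linear_compose[OF linear_compose[OF inv_linear[OF \<phi>] linear_right] \<phi>(1)]
      by (simp add: q_def o_def)
    show "q x y = q y x" for x y
      by (simp add: q_def commute)
    show "q (q x y) z = q x (q y z)" for x y z
      by (simp add: q_def assoc)
  qed
  moreover have "algebra_isomorphic p q"
    unfolding algebra_isomorphic_def using \<phi> by (intro exI[of _ \<phi>]) (simp add: q_def)
  ultimately show thesis by (rule that)
qed

theorem proposition4p1: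
  fixes br :: "'g::real_vector \<Rightarrow> 'g \<Rightarrow> 'g"
  assumes "real_lie_algebra br"
    and "dim (UNIV :: 'g set) = 2"
    and "abelian_bracket br"
  shows "card ((affine_structures br :: ('g \<Rightarrow> 2 mat_ext) set) // affine_equivalence br) = 6"
proof -
  obtain u v :: 'g where uv: "bij (comb u v)"
    by (rule bij_comb_exists[OF assms(2)])
  obtain u' v' :: "real^2" where uv': "bij (comb u' v')"
    using bij_comb_exists[where 'a = "real^2"] by auto
  \<comment> \<open>Matching a basis of \<open>'g\<close> with one of \<open>real^2\<close> gives
    the translation part for all structures built below.\<close>
  define \<beta> where "\<beta> = comb u' v' \<circ> inv (comb u v)"
  have \<beta>: "linear \<beta>" "bij \<beta>"
    unfolding \<beta>_def using uv uv'
    by (auto intro!: linear_compose inv_linear linear_comb bij_comp bij_imp_bij_inv)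
  have "\<exists>\<Psi> :: 'g \<Rightarrow> 2 mat_ext.
      \<Psi> \<in> affine_structures br \<and> algebra_isomorphic (table T) (affine_product \<Psi>)"
    if T: "T \<in> canonical_tables" for T
  proof -
    obtain q :: "'g \<Rightarrow> 'g \<Rightarrow> 'g" where q: "comm_assoc_algebra q" "algebra_isomorphic (table T) q"
      by (rule algebra_isomorphic_transport[OF comm_assoc_canonical_table[OF T] linear_comb uv])
    obtain \<Psi> :: "'g \<Rightarrow> 2 mat_ext" where "affine_structure br \<Psi>" "affine_product \<Psi> = q"
      by (rule comm_assoc_algebra_is_affine_product[OF assms(3) q(1) \<beta>])
    then show ?thesis using q(2) by (auto simp: affine_structures_def)
  qed
  \<comment> \<open>One affine structure is chosen for each canonical table; these represent the
    classes.\<close>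
  then obtain F :: "_ \<Rightarrow> 'g \<Rightarrow> 2 mat_ext"
    where F: "\<And>T. T \<in> canonical_tables \<Longrightarrow> F T \<in> affine_structures br"
      "\<And>T. T \<in> canonical_tables \<Longrightarrow> algebra_isomorphic (table T) (affine_product (F T))"
    by metis
  have "card ((affine_structures br :: ('g \<Rightarrow> 2 mat_ext) set) // affine_equivalence br)
      = card canonical_tables"
  proof (rule card_quotient_eq[OF equiv_affine_equivalence, of _ F])
    fix \<Psi> :: "'g \<Rightarrow> 2 mat_ext"
    assume \<Psi>: "\<Psi> \<in> affine_structures br"
    then interpret comm_assoc_algebra "affine_product \<Psi>"
      by (intro comm_assoc_affine_product[OF assms(3)]) (simp add: affine_structures_def)
    obtain T where T: "T \<in> canonical_tables" "algebra_isomorphic (table T) (affine_product \<Psi>)"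
      using classification[OF assms(2)] by blast
    then have "(F T, \<Psi>) \<in> affine_equivalence br"
      using F(1)[OF T(1)] \<Psi> algebra_isomorphic_trans[OF algebra_isomorphic_sym[OF F(2)[OF T(1)]] T(2)]
      by (simp add: affine_equivalence_def)
    with T(1) show "\<exists>T\<in>canonical_tables. (F T, \<Psi>) \<in> affine_equivalence br" by blast
  next
    fix S T
    assume ST: "S \<in> canonical_tables" "T \<in> canonical_tables"
      and "(F S, F T) \<in> affine_equivalence br"
    then have "algebra_isomorphic (affine_product (F S)) (affine_product (F T))"
      by (simp add: affine_equivalence_def)
    then have "algebra_isomorphic (table S) (table T)"
      using F(2)[OF ST(1)] F(2)[OF ST(2)]
      by (metis algebra_isomorphic_trans algebra_isomorphic_sym)
    then show "S = T" by (rule canonical_tables_distinct[OF ST])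
  qed (rule F)
  then show ?thesis by (simp add: card_canonical_tables)
qed

end
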